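(* Suppose that $X$ and $Y$ are Polish spaces and $f \colon X \to Y$ is an $F_\sigma$-to-one Baire-class one function. Then exactly one of the following holds: (1) The function $f$ is $\sigma$-continuous with closed witnesses. (2) There is a topological embedding of $f_1$ into $f$.
   Context: A subset of a topological space is $F_\sigma$ if it is a union of countably-many closed sets. A function between topological spaces is Baire class one if preimages of open sets are $F_\sigma$; $F_\sigma$-to-one if the preimage of each singleton is $F_\sigma$; and $\sigma$-continuous with closed witnesses if its domain is a union of countably-many closed sets on each of which it is continuous. Let $\mathbb{N}^{<\mathbb{N}}$ be the set of finite sequences of natural numbers, $\mathbb{N}^{\mathbb{N}}$ the set of infinite sequences of natural numbers, and $\mathbb{N}^{\le\mathbb{N}} = \mathbb{N}^{<\mathbb{N}} \cup \mathbb{N}^{\mathbb{N}}$. Write $s \sqsubseteq t$ if $t$ extends $s$. For $s \in \mathbb{N}^{<\mathbb{N}}$ put $\mathcal{N}_s^* = \{t \in \mathbb{N}^{\le\mathbb{N}} \mid s \sqsubseteq t\}$. Let $\mathbb{N}^{\le\mathbb{N}}_*$ denote $\mathbb{N}^{\le\mathbb{N}}$ equipped with the smallest topology making the sets $\mathcal{N}_s^*$ clopen for all $s \in \mathbb{N}^{<\mathbb{N}}$, and let $\mathbb{N}^{\le\mathbb{N}}_{**}$ denote $\mathbb{N}^{\le\mathbb{N}}$ equipped with the smallest topology making the sets $\mathcal{N}_s^*$ and $\{s\}$ clopen for all $s \in \mathbb{N}^{<\mathbb{N}}$. Define $f_1 \colon \mathbb{N}^{\le\mathbb{N}}_* \to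 \mathbb{N}^{\le\mathbb{N}}_{**}$ by $f_1(s) = s$. A topological embedding of a topological space $X$ into a topological space $Y$ is a function $\pi \colon X \to Y$ which is a homeomorphism onto its image, where the image carries the subspace topology. A topological embedding of a function $f \colon X \to Y$ into a function $f' \colon X' \to Y'$ is a pair $(\pi_X, \pi_Y)$ consisting of topological embeddings $\pi_X$ of $X$ into $X'$ and $\pi_Y$ of $f(X)$ into $f'(X')$ (with the subspace topologies) such that $f' \circ \pi_X = \pi_Y \circ f$. *)

theory Defs
  imports "HOL-Analysis.Analysis" "HOL-Library.Sublist"
begin

text \<open>Polish spaces are rendered as abstract topologies rather than through the type class
  \<^class>\<open>polish_space\<close>: two topologies on one carrier are needed below, and the empty space
  is admitted.\<close>

definition Polish_space :: "'a topology \<Rightarrow> bool" where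
  "Polish_space X \<longleftrightarrow> separable_space X \<and> completely_metrizable_space X"

definition Baire_class_one :: "'a topology \<Rightarrow> 'b topology \<Rightarrow> ('a \<Rightarrow> 'b) \<Rightarrow> bool" where
  "Baire_class_one X Y f \<longleftrightarrow> (\<forall>U. openin Y U \<longrightarrow> fsigma_in X {x \<in> topspace X. f x \<in> U})"

definition fsigma_to_one :: "'a topology \<Rightarrow> 'b topology \<Rightarrow> ('a \<Rightarrow> 'b) \<Rightarrow> bool" where
  "fsigma_to_one X Y f \<longleftrightarrow> (\<forall>y \<in> topspace Y. fsigma_in X {x \<in> topspace X. f x = y})"

definition sigma_continuous_closed :: "'a topology \<Rightarrow> 'b topology \<Rightarrow> ('a \<Rightarrow> 'b) \<Rightarrow> bool" where
  "sigma_continuous_closed X Y f \<longleftrightarrow>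
     (\<exists>\<C>. countable \<C> \<and> (\<forall>C \<in> \<C>. closedin X C) \<and> \<Union>\<C> = topspace X \<and>
          (\<forall>C \<in> \<C>. continuous_map (subtopology X C) Y f))"

definition function_embedding ::
  "'a topology \<Rightarrow> 'b topology \<Rightarrow> ('a \<Rightarrow> 'b) \<Rightarrow> 'c topology \<Rightarrow> 'd topology \<Rightarrow> ('c \<Rightarrow> 'd) \<Rightarrow>
    ('a \<Rightarrow> 'c) \<Rightarrow> ('b \<Rightarrow> 'd) \<Rightarrow> bool" where
  "function_embedding X Y f X' Y' f' \<pi>X \<pi>Y \<longleftrightarrow>
     embedding_map X X' \<pi>X \<and>
     embedding_map (subtopology Y (f ` topspace X)) (subtopology Y' (f' ` topspace X')) \<pi>Y \<and>
     (\<forall>x \<in> topspace X. f' (\<pi>X x) = \<pi>Y (f x))"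

datatype natseq = Fin "nat list" | Inf "nat \<Rightarrow> nat"

fun extends :: "nat list \<Rightarrow> natseq \<Rightarrow> bool" where
  "extends s (Fin t) \<longleftrightarrow> prefix s t"
| "extends s (Inf b) \<longleftrightarrow> s = map b [0..<length s]"

definition cyl :: "nat list \<Rightarrow> natseq set" where
  "cyl s = {t. extends s t}"

text \<open>The smallest topology on the whole type in which every member of a nonempty family \<open>\<A>\<close>
  is clopen; see \<open>clopen_topology_clopen\<close> and \<open>clopen_topology_least\<close>.\<close>

definition clopen_topology :: "'a set set \<Rightarrow> 'a topology" where
  "clopen_topology \<A> = topology_generated_by (\<A> \<union> uminus ` \<A>)"

lemma topspace_clopen_topology:
  assumes "\<A> \<noteq> {}"
  shows "topspace (clopen_topology \<A>) = UNIV"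
  using assms by (auto simp: clopen_topology_def topology_generated_by_topspace)

lemma clopen_topology_clopen:
  assumes "A \<in> \<A>"
  shows "openin (clopen_topology \<A>) A" and "closedin (clopen_topology \<A>) A"
proof -
  have "\<A> \<noteq> {}" using assms by blast
  note top = topspace_clopen_topology[OF this]
  show "openin (clopen_topology \<A>) A"
    using assms unfolding clopen_topology_def by (intro topology_generated_by_Basis) blast
  have "openin (clopen_topology \<A>) (- A)"
    using assms unfolding clopen_topology_def by (intro topology_generated_by_Basis) blast
  then show "closedin (clopen_topology \<A>) A"
    by (simp add: closedin_def top Compl_eq_Diff_UNIV)
qed

lemma clopen_topology_least:
  assumes "topspace T = UNIV" and "\<And>A. A \<in> \<A> \<Longrightarrow> openin T A \<and> closedin T A"
    and "openin (clopen_topology \<A>) U"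
  shows "openin T U"
proof -
  have "generate_topology_on (\<A> \<union> uminus ` \<A>) U"
    using assms(3) by (simp add: clopen_topology_def openin_topology_generated_by_iff)
  moreover have "openin T S" if "S \<in> \<A> \<union> uminus ` \<A>" for S
    using that assms(1,2) by (auto simp: closedin_def Compl_eq_Diff_UNIV)
  ultimately show ?thesis
    by (induction rule: generate_topology_on.induct) auto
qed

definition natseq_star :: "natseq topology" where
  "natseq_star = clopen_topology (range cyl)"

definition natseq_star_star :: "natseq topology" where
  "natseq_star_star = clopen_topology (range cyl \<union> range (\<lambda>s. {Fin s}))"

definition f1 :: "natseq \<Rightarrow> natseq" where
  "f1 s = s"

end

theory Submission
  imports Defs
begin

text \<open>The two alternatives exclude each other because \<sigma>-continuity with closed witnesses passes
to embedded functions, and \<open>f1\<close> does not have it. If a closed set \<open>C\<close> carries a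
continuous restriction of \<open>f1\<close>, then every cylinder has a proper subcylinder that misses
\<open>C\<close> (\<open>closed_continuous_avoids_cyl\<close>): otherwise \<open>C\<close> would contain a
finite sequence together with all its one-point extensions, which converge to it in the coarse topology
while it is isolated in the fine one. Diagonalizing against countably many such sets gives an infinite
sequence in none of them.

For existence, call a set small if countably many closed sets, on each of which \<open>f\<close> is
continuous, cover it. Small sets form a \<sigma>-ideal, and \<open>f\<close> is \<sigma>-continuous
with closed witnesses exactly when the whole space is small. Suppose it is not. For a closed nonsmall
set \<open>F\<close>, let \<open>K\<close> be the set of points of \<open>F\<close> near which, with
values near their own, \<open>F\<close> stays nonsmall. Second countability makes \<open>F - K\<close>
small. Hence the closure of \<open>K\<close> is nonsmall, \<open>f\<close> is not continuous on it, and
there are \<open>x \<in> F\<close> and points of \<open>K\<close> tending to \<open>x\<close> whose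
values stay away from \<open>f x\<close> (\<open>kernel_discontinuity\<close>). The fibres of
\<open>f\<close> are small because they are \<open>F\<^sub>\<sigma>\<close>, so the points can be moved slightly
within \<open>K\<close> to have distinct values (\<open>kernel_point_avoiding\<close>). After passing to
a subsequence, these points and their values have pairwise disjoint neighbourhoods. Since \<open>f\<close> is
of Baire class one, the part of \<open>F\<close> in a neighbourhood of such a point with values in a
neighbourhood of its value is \<open>F\<^sub>\<sigma>\<close>. It is not small, so it contains a nonsmall closed
set. These closed sets are the children of \<open>F\<close> (\<open>splitting_exists\<close>).

Iterating yields closed sets \<open>F s\<close> indexed by finite sequences, with a point
\<open>x s\<close> in each. Both the \<open>F s\<close> and their images shrink along branches, and the
children of \<open>F s\<close> converge to \<open>x s\<close> while their images avoid a neighbourhood of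
\<open>f (x s)\<close>. Mapping a finite sequence \<open>s\<close> to \<open>x s\<close> and an infinite one to
the intersection of the sets along its branch embeds the coarse topology into the domain, and composing
with \<open>f\<close> embeds the fine one into the range (\<open>embeds_f1\<close>). Points of
branches lie in the closed sets themselves, and this is why \<open>f\<close> needs no continuity there:
their values are controlled by the images of these sets.\<close>

section \<open>Cylinders and the two topologies on finite and infinite sequences\<close>

lemma cyl_Nil: "cyl [] = UNIV"
proof -
  have "extends [] c" for c by (cases c) auto
  then show ?thesis by (auto simp: cyl_def)
qed

lemma cyl_snoc_subset: "cyl (s @ [i]) \<subseteq> cyl s"
proof
  fix c assume "c \<in> cyl (s @ [i])"
  then show "c \<in> cyl s"
    by (cases c) (auto simp: cyl_def append_prefixD)
qed

lemma cyl_split: "cyl s = insert (Fin s) (\<Union>i. cyl (s @ [i]))"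
proof
  show "cyl s \<subseteq> insert (Fin s) (\<Union>i. cyl (s @ [i]))"
  proof
    fix c assume c: "c \<in> cyl s"
    show "c \<in> insert (Fin s) (\<Union>i. cyl (s @ [i]))"
    proof (cases c)
      case (Fin t)
      with c obtain r where "t = s @ r" by (auto simp: cyl_def prefix_def)
      with Fin show ?thesis by (cases r) (auto simp: cyl_def)
    next
      case (Inf b)
      with c have "c \<in> cyl (s @ [b (length s)])" by (simp add: cyl_def)
      then show ?thesis by blast
    qed
  qed
  show "insert (Fin s) (\<Union>i. cyl (s @ [i])) \<subseteq> cyl s"
    using cyl_snoc_subset by (auto simp: cyl_def)
qed

lemma cyl_snoc_unique: "\<lbrakk>c \<in> cyl (s @ [i]); c \<in> cyl (s @ [j])\<rbrakk> \<Longrightarrow> i = j"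
  by (cases c) (auto simp: cyl_def prefix_def)

lemma Fin_notin_cyl_snoc: "Fin s \<notin> cyl (s @ [i])"
  by (auto simp: cyl_def)

lemma Fin_in_cyl: "Fin s \<in> cyl s"
  by (simp add: cyl_def)

lemma Inf_in_cyl_iff: "Inf b \<in> cyl s \<longleftrightarrow> s = map b [0..<length s]"
  by (simp add: cyl_def)

lemma natseq_eqI:
  assumes "\<And>s. c \<in> cyl s \<longleftrightarrow> c' \<in> cyl s"
  shows "c = c'"
proof (cases c; cases c')
  fix s t assume "c = Fin s" "c' = Fin t"
  then show ?thesis using assms[of s] assms[of t] by (simp add: cyl_def)
next
  fix s b assume "c = Fin s" "c' = Inf b"
  then show ?thesis using assms[of "map b [0..<Suc (length s)]"]
    by (auto simp: cyl_def dest: prefix_length_le)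
next
  fix s b assume "c = Inf b" "c' = Fin s" 
  then show ?thesis using assms[of "map b [0..<Suc (length s)]"]
    by (auto simp: cyl_def dest: prefix_length_le)
next
  fix a b assume ab: "c = Inf a" "c' = Inf b" 
  have "a n = b n" for n
    using assms[of "map a [0..<Suc n]"] ab by (auto simp: cyl_def)
  then show ?thesis using ab by auto
qed

lemma Compl_cyl_snoc: "- cyl (s @ [i]) = - cyl s \<union> {Fin s} \<union> (\<Union>j\<in>-{i}. cyl (s @ [j]))"
proof (rule set_eqI)
  fix c
  consider "c \<notin> cyl s" | "c = Fin s" | j where "c \<in> cyl (s @ [j])"
    using cyl_split[of s] by blast
  then show "c \<in> - cyl (s @ [i]) \<longleftrightarrow> c \<in> - cyl s \<union> {Fin s} \<union> (\<Union>j\<in>-{i}. cyl (s @ [j]))"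
  proof cases
    case 1
    then show ?thesis using cyl_snoc_subset[of s i] by auto
  next
    case 2
    then show ?thesis using Fin_notin_cyl_snoc[of s i] by auto
  next
    case (3 j)
    then have "c \<in> cyl s" "c \<noteq> Fin s" "\<And>k. c \<in> cyl (s @ [k]) \<longleftrightarrow> k = j"
      using cyl_snoc_subset Fin_notin_cyl_snoc cyl_snoc_unique by blast+
    then show ?thesis by auto
  qed
qed

lemma openin_Compl_cyl:
  assumes "\<And>s. openin T (cyl s)" "\<And>s. openin T {Fin s}"
  shows "openin T (- cyl s)"
proof (induction s rule: rev_induct)
  case Nil
  then show ?case by (simp add: cyl_Nil)
next
  case (snoc i s)
  then show ?case unfolding Compl_cyl_snoc using assms by (intro openin_Un openin_Union) auto
qed

text \<open>The complements of the basic clopen sets are unions of basic ones, so they may be dropped from the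
subbasis. To embed the fine topology it is then enough to separate cylinders and finite sequences
from everything else.\<close>

lemma natseq_star_star_eq:
  "natseq_star_star = topology_generated_by (range cyl \<union> range (\<lambda>s. {Fin s}))" (is "_ = ?T")
proof -
  let ?\<A> = "range cyl \<union> range (\<lambda>s. {Fin s})"
  have T: "openin ?T A" if "A \<in> ?\<A>" for A
    using that by (rule topology_generated_by_Basis)
  have top: "topspace ?T = UNIV"
    unfolding topology_generated_by_topspace using cyl_Nil by blast
  have cylc: "openin ?T (- cyl s)" for s
    by (rule openin_Compl_cyl) (auto intro!: T)
  have finc: "openin ?T (- {Fin s})" for s
  proof -
    have eq: "- {Fin s} = - cyl s \<union> (\<Union>i. cyl (s @ [i]))"
      using cyl_split[of s] Fin_notin_cyl_snoc[of s] by blast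
    show ?thesis unfolding eq using cylc T by (intro openin_Un openin_Union) auto
  qed
  have "openin natseq_star_star S = openin ?T S" for S
  proof
    assume "openin natseq_star_star S"
    then show "openin ?T S"
      unfolding natseq_star_star_def
    proof (rule clopen_topology_least[OF top, rotated])
      fix A assume "A \<in> ?\<A>"
      then show "openin ?T A \<and> closedin ?T A"
        using T cylc finc unfolding closedin_def top Compl_eq_Diff_UNIV by blast
    qed
  next
    assume "openin ?T S"
    then have "generate_topology_on ?\<A> S"
      by (simp add: openin_topology_generated_by_iff)
    then show "openin natseq_star_star S"
      unfolding natseq_star_star_def
      by (induction rule: generate_topology_on.induct) (auto intro: clopen_topology_clopen)
  qed
  then show ?thesis by (simp add: topology_eq)
qed

lemma topspace_natseq_star [simp]: "topspace natseq_star = UNIV"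
  by (simp add: natseq_star_def topspace_clopen_topology)

lemma topspace_natseq_star_star [simp]: "topspace natseq_star_star = UNIV"
  by (simp add: natseq_star_star_def topspace_clopen_topology)

lemma natseq_star_clopen: "openin natseq_star (cyl s)" "closedin natseq_star (cyl s)"
  unfolding natseq_star_def by (rule clopen_topology_clopen, rule rangeI)+

lemma natseq_star_star_open: "openin natseq_star_star (cyl s)" "openin natseq_star_star {Fin s}"
  unfolding natseq_star_star_def by (rule clopen_topology_clopen, blast)+

text \<open>These sets form a neighbourhood base at \<open>Fin s\<close> in the coarse topology; see
\<open>cofinite_cyl_neighbourhood\<close>.\<close>

definition cofinite_cyl :: "nat list \<Rightarrow> nat \<Rightarrow> natseq set" where
  "cofinite_cyl s k = cyl s - (\<Union>i<k. cyl (s @ [i]))"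

lemma openin_cofinite_cyl: "openin natseq_star (cofinite_cyl s k)"
proof -
  have "closedin natseq_star (\<Union>i<k. cyl (s @ [i]))"
    by (rule closedin_Union) (use natseq_star_clopen(2) in blast)+
  then show ?thesis
    unfolding cofinite_cyl_def by (rule openin_diff[OF natseq_star_clopen(1)])
qed

lemma Fin_in_cofinite_cyl: "Fin s \<in> cofinite_cyl s k"
  by (auto simp: cofinite_cyl_def Fin_in_cyl Fin_notin_cyl_snoc)

lemma cofinite_cyl_cases:
  assumes "c \<in> cofinite_cyl s k" 
  obtains "c = Fin s" | i where "k \<le> i" "c \<in> cyl (s @ [i])"
proof (cases "c = Fin s")
  case False
  with assms obtain i where "c \<in> cyl (s @ [i])"
    using cyl_split[of s] by (auto simp: cofinite_cyl_def)
  moreover from this have "k \<le> i"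
    using assms by (force simp: cofinite_cyl_def)
  ultimately show thesis by (rule that(2)[rotated])
qed (rule that(1))

lemma cyl_antimono: "Fin s \<in> cyl t \<Longrightarrow> cyl s \<subseteq> cyl t"
proof (induction s rule: rev_induct)
  case Nil then show ?case by (simp add: cyl_def)
next
  case (snoc i s) then show ?case using cyl_snoc_subset[of s i] by (auto simp: cyl_def)
qed

text \<open>If \<open>t\<close> is not a prefix of \<open>s\<close>, its cylinder can meet that of \<open>s\<close> only
through a single immediate successor of \<open>s\<close>, which is excluded for large \<open>k\<close>.\<close>

lemma cofinite_cyl_avoids_cyl:
  assumes "Fin s \<notin> cyl t"
  shows "\<exists>k. cofinite_cyl s k \<inter> cyl t = {}"
  using assms
proof (induction t rule: rev_induct)
  case Nil
  then show ?case by (simp add: cyl_Nil)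
next
  case (snoc i t)
  show ?case
  proof (cases "Fin s \<in> cyl t")
    case True
    then consider "s = t" | j where "Fin s \<in> cyl (t @ [j])"
      using cyl_split[of t] by blast
    then show ?thesis
    proof cases
      case 1
      then show ?thesis by (intro exI[of _ "Suc i"]) (auto simp: cofinite_cyl_def)
    next
      case (2 j)
      with snoc.prems have "j \<noteq> i" by blast
      then show ?thesis
        using cyl_antimono[OF 2] cyl_snoc_unique unfolding cofinite_cyl_def by blast
    qed
  next
    case False
    then show ?thesis using snoc.IH cyl_snoc_subset[of t i] by blast
  qed
qed

lemma cofinite_cyl_neighbourhood:
  assumes "openin natseq_star S" "Fin s \<in> S"
  shows "\<exists>k. cofinite_cyl s k \<subseteq> S"
proof -
  have "generate_topology_on (range cyl \<union> uminus ` range cyl) S"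
    using assms(1) by (simp add: natseq_star_def clopen_topology_def openin_topology_generated_by_iff)
  then show ?thesis using assms(2)
  proof (induction rule: generate_topology_on.induct)
    case (Int a b)
    then obtain k l where "cofinite_cyl s k \<subseteq> a" "cofinite_cyl s l \<subseteq> b" by auto
    moreover have "cofinite_cyl s (max k l) \<subseteq> cofinite_cyl s k \<inter> cofinite_cyl s l"
      by (auto simp: cofinite_cyl_def)
    ultimately show ?case by blast
  next
    case (UN K)
    then show ?case by blast
  next
    case (Basis A)
    from Basis consider t where "A = cyl t" | t where "A = - cyl t" by blast
    then show ?case
    proof cases
      case (1 t)
      then have "cofinite_cyl s 0 \<subseteq> A"
        using Basis(2) cyl_antimono[of s t] by (auto simp: cofinite_cyl_def)
      then show ?thesis by blast
    next
      case (2 t)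
      then show ?thesis using Basis(2) cofinite_cyl_avoids_cyl[of s t] by blast
    qed
  qed auto
qed

section \<open>The function \<open>f1\<close> is not \<open>\<sigma>\<close>-continuous with closed witnesses\<close>

text \<open>If \<open>C\<close> met every proper subcylinder, then, being closed, it would contain
all finite extensions of \<open>s\<close>. The immediate successors of \<open>s\<close> converge to \<open>s\<close> in
the coarse topology but not in the fine one, contrary to continuity on \<open>C\<close>.\<close>

lemma closed_continuous_avoids_cyl:
  assumes C: "closedin natseq_star C"
    and cont: "continuous_map (subtopology natseq_star C) natseq_star_star f1"
  shows "\<exists>i r. C \<inter> cyl (s @ i # r) = {}"
proof (rule ccontr)
  assume "\<not> ?thesis"
  then have meets: "C \<inter> cyl (s @ i # r) \<noteq> {}" for i r by blast
  have in_C: "Fin (s @ r) \<in> C" for r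
  proof (rule ccontr)
    assume "Fin (s @ r) \<notin> C"
    moreover have "openin natseq_star (- C)"
      using C by (simp add: closedin_def Compl_eq_Diff_UNIV)
    ultimately obtain k where k: "cofinite_cyl (s @ r) k \<subseteq> - C"
      using cofinite_cyl_neighbourhood by blast
    have "cyl ((s @ r) @ [k]) \<subseteq> cofinite_cyl (s @ r) k"
      using cyl_snoc_subset cyl_snoc_unique unfolding cofinite_cyl_def by blast
    then have "C \<inter> cyl ((s @ r) @ [k]) = {}" using k by blast
    moreover have "\<exists>i r'. (s @ r) @ [k] = s @ i # r'" by (cases r) auto
    ultimately show False using meets by metis
  qed
  have "openin (subtopology natseq_star C) {c \<in> topspace (subtopology natseq_star C). f1 c \<in> {Fin s}}"
    using cont natseq_star_star_open(2) by (rule openin_continuous_map_preimage)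
  then obtain S where S: "openin natseq_star S" "{c \<in> C. c = Fin s} = S \<inter> C"
    by (auto simp: openin_subtopology f1_def)
  then have "Fin s \<in> S" using in_C[of "[]"] by auto
  then obtain k where "cofinite_cyl s k \<subseteq> S" using cofinite_cyl_neighbourhood S(1) by blast
  moreover have "Fin (s @ [k]) \<in> cofinite_cyl s k"
    by (auto simp: cofinite_cyl_def cyl_def prefix_def)
  ultimately have "Fin (s @ [k]) \<in> S \<inter> C" using in_C by blast
  with S(2) show False by auto
qed

lemma f1_not_sigma_continuous_closed: "\<not> sigma_continuous_closed natseq_star natseq_star_star f1"
proof
  assume "sigma_continuous_closed natseq_star natseq_star_star f1"
  then obtain \<C> where \<C>: "countable \<C>" "\<Union>\<C> = UNIV"
    "\<forall>C\<in>\<C>. closedin natseq_star C"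
    "\<forall>C\<in>\<C>. continuous_map (subtopology natseq_star C) natseq_star_star f1"
    unfolding sigma_continuous_closed_def topspace_natseq_star by blast
  from \<C>(2) have "\<C> \<noteq> {}" by blast
  define C where "C = from_nat_into \<C>"
  have "range C = \<C>" unfolding C_def using \<open>\<C> \<noteq> {}\<close> \<C>(1) by (rule range_from_nat_into)
  then have "\<exists>i r. C n \<inter> cyl (s @ i # r) = {}" for n s
    by (intro closed_continuous_avoids_cyl) (use \<C>(3,4) in blast)+
  then obtain i r where ir: "\<And>n s. C n \<inter> cyl (s @ i n s # r n s) = {}" by metis
  define t where "t = rec_nat [] (\<lambda>n s. s @ i n s # r n s)"
  have t_Suc: "t (Suc n) = t n @ i n (t n) # r n (t n)" for n
    by (simp add: t_def)
  \<comment> \<open>Stage \<open>n + 1\<close> avoids \<open>C n\<close>; the infinite sequence \<open>b\<close> below is the union of all stages.\<close>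
  have pre: "prefix (t m) (t n)" if "m \<le> n" for m n
    using that by (induction n rule: dec_induct) (auto simp: t_Suc)
  have len: "n \<le> length (t n)" for n
    by (induction n) (auto simp: t_Suc)
  define b where "b k = t (Suc k) ! k" for k
  have nth_b: "t n ! k = b k" if "k < length (t n)" for n k
  proof -
    have "k < length (t (Suc k))" using len[of "Suc k"] by simp
    then show ?thesis
      using that pre[of n "Suc k"] pre[of "Suc k" n] unfolding b_def
      by (metis linear nth_append prefix_def)
  qed
  have "Inf b \<in> cyl (t n)" for n
    unfolding Inf_in_cyl_iff by (rule nth_equalityI) (auto simp: nth_b)
  then have "Inf b \<notin> C n" for n
    using ir[of n "t n"] unfolding t_Suc[of n, symmetric] by blast
  then show False using \<open>range C = \<C>\<close> \<C>(2) by blast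
qed

text \<open>Pull the closed witnesses back along \<open>\<pi>X\<close>; on each preimage, continuity of \<open>g\<close> is
that of \<open>\<pi>Y \<circ> g\<close>, since \<open>\<pi>Y\<close> has a continuous inverse on its range.\<close>

lemma sigma_continuous_closed_if_embeds:
  assumes emb: "function_embedding X Y g X' Y' f \<pi>X \<pi>Y"
    and g: "g \<in> topspace X \<rightarrow> topspace Y"
    and f: "sigma_continuous_closed X' Y' f"
  shows "sigma_continuous_closed X Y g"
proof -
  from f obtain \<C> where \<C>: "countable \<C>" "\<Union>\<C> = topspace X'"
    "\<forall>C\<in>\<C>. closedin X' C" "\<forall>C\<in>\<C>. continuous_map (subtopology X' C) Y' f"
    unfolding sigma_continuous_closed_def by blast
  let ?Y = "subtopology Y (g ` topspace X)"
  have \<pi>X: "continuous_map X X' \<pi>X"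
    and \<pi>Y: "embedding_map ?Y Y' \<pi>Y"
    and comm: "\<And>x. x \<in> topspace X \<Longrightarrow> f (\<pi>X x) = \<pi>Y (g x)"
    using emb homeomorphic_imp_continuous_map[of X "subtopology X' (\<pi>X ` topspace X)" \<pi>X]
    unfolding function_embedding_def embedding_map_in_subtopology
    by (simp_all add: embedding_map_def continuous_map_in_subtopology)
  have top: "topspace ?Y = g ` topspace X" using g by auto
  obtain h where h: "continuous_map (subtopology Y' (\<pi>Y ` g ` topspace X)) ?Y h"
    "\<And>x. x \<in> topspace X \<Longrightarrow> h (\<pi>Y (g x)) = g x"
    using \<pi>Y unfolding embedding_map_def homeomorphic_map_maps homeomorphic_maps_def top by blast
  define P where "P C = {x \<in> topspace X. \<pi>X x \<in> C}" for C
  have "continuous_map (subtopology X (P C)) Y g" if "C \<in> \<C>" for C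
  proof -
    have "continuous_map (subtopology X (P C)) (subtopology X' C) \<pi>X"
      unfolding continuous_map_in_subtopology
      using continuous_map_from_subtopology[OF \<pi>X] by (simp add: P_def Pi_iff)
    then have "continuous_map (subtopology X (P C)) Y' (f \<circ> \<pi>X)"
      using \<C>(4)[rule_format, OF that] by (rule continuous_map_compose)
    then have "continuous_map (subtopology X (P C)) (subtopology Y' (\<pi>Y ` g ` topspace X)) (f \<circ> \<pi>X)"
      unfolding continuous_map_in_subtopology by (simp add: comm image_subset_iff Pi_iff)
    then have "continuous_map (subtopology X (P C)) ?Y (h \<circ> (f \<circ> \<pi>X))"
      using h(1) by (rule continuous_map_compose)
    then have "continuous_map (subtopology X (P C)) ?Y g"
      by (rule continuous_map_eq) (simp add: comm h(2))
    then show ?thesis by (simp add: continuous_map_in_subtopology)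
  qed
  moreover have "closedin X (P C)" if "C \<in> \<C>" for C
    unfolding P_def using \<pi>X \<C>(3)[rule_format, OF that] by (rule closedin_continuous_map_preimage)
  moreover have "\<Union>(P ` \<C>) = topspace X"
    using \<C>(2) continuous_map_image_subset_topspace[OF \<pi>X] by (fastforce simp: P_def)
  ultimately show ?thesis
    unfolding sigma_continuous_closed_def using \<C>(1) by (intro exI[of _ "P ` \<C>"]) auto
qed

section \<open>Embedding \<open>f1\<close> along a tree of closed sets\<close>

lemma ex_two_over_Suc_less:
  assumes "(e :: real) > 0"
  shows "\<exists>n. 2 / real (Suc n) < e"
proof -
  obtain n where "inverse (real (Suc n)) < e / 2"
    using reals_Archimedean[of "e / 2"] assms by auto
  then have "2 * inverse (real (Suc n)) < e" by linarith
  then show ?thesis unfolding divide_inverse by blast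
qed

text \<open>For an injective map, openness onto the image has to be tested on a subbasis only, in the form
that subbasic sets are traces of open sets of the target.\<close>

lemma embedding_map_generated:
  assumes cont: "continuous_map (topology_generated_by S) Z g" and cov: "\<Union>S = UNIV"
    and inj: "inj g"
    and sep: "\<And>A. A \<in> S \<Longrightarrow> \<exists>Q. openin Z Q \<and> (\<forall>c. g c \<in> Q \<longleftrightarrow> c \<in> A)"
  shows "embedding_map (topology_generated_by S) Z g"
proof -
  have top: "topspace (topology_generated_by S) = UNIV"
    unfolding topology_generated_by_topspace by (rule cov)
  have "continuous_map (subtopology Z (range g)) (topology_generated_by S) (inv g)"
  proof (rule continuous_on_generated_topo)
    fix A assume "A \<in> S"
    then obtain Q where Q: "openin Z Q" "\<forall>c. g c \<in> Q \<longleftrightarrow> c \<in> A" using sep by blast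
    have "inv g -` A \<inter> topspace (subtopology Z (range g)) = Q \<inter> range g"
      using openin_subset[OF Q(1)] Q(2) inj by auto
    then show "openin (subtopology Z (range g)) (inv g -` A \<inter> topspace (subtopology Z (range g)))"
      using Q(1) by (auto simp: openin_subtopology)
  qed (simp add: cov)
  then have "homeomorphic_maps (topology_generated_by S) (subtopology Z (range g)) g (inv g)"
    using cont inj by (auto simp: homeomorphic_maps_def continuous_map_in_subtopology top)
  then show ?thesis
    unfolding embedding_map_def top homeomorphic_map_maps by blast
qed

text \<open>Going down the tree, the set \<open>N s i\<close> isolates the values on the child \<open>s @ [i]\<close> from those
on its siblings and from the value at the node \<open>s\<close>. The image of a cylinder is thus cut out by the
finitely many such sets along \<open>s\<close>. The lemma applies both to the map into the domain of \<open>f\<close> and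
to its composition with \<open>f\<close>.\<close>

lemma cylinders_separated:
  assumes N: "\<And>s i. openin Z (N s i)"
    and sib: "\<And>s i j. i \<noteq> j \<Longrightarrow> N s i \<inter> N s j = {}"
    and child: "\<And>s i c. c \<in> cyl (s @ [i]) \<Longrightarrow> g c \<in> N s i"
    and root: "\<And>s i. g (Fin s) \<notin> N s i"
    and top: "\<And>c. g c \<in> topspace Z"
  shows "\<exists>Q. openin Z Q \<and> (\<forall>c. g c \<in> Q \<longleftrightarrow> c \<in> cyl s)"
proof (induction s rule: rev_induct)
  case Nil
  then show ?case using top by (intro exI[of _ "topspace Z"]) (simp add: cyl_Nil)
next
  case (snoc i s)
  then obtain Q where Q: "openin Z Q" "\<And>c. g c \<in> Q \<longleftrightarrow> c \<in> cyl s" by blast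
  have "g c \<in> Q \<inter> N s i \<longleftrightarrow> c \<in> cyl (s @ [i])" for c
  proof
    assume c: "g c \<in> Q \<inter> N s i"
    then have "c \<in> cyl s" "c \<noteq> Fin s" using Q(2) root by auto
    then obtain j where j: "c \<in> cyl (s @ [j])" using cyl_split[of s] by blast
    then have "g c \<in> N s j" by (rule child)
    with c sib[of i j s] have "i = j" by blast
    with j show "c \<in> cyl (s @ [i])" by simp
  next
    assume "c \<in> cyl (s @ [i])"
    then show "g c \<in> Q \<inter> N s i" using Q(2) child cyl_snoc_subset by blast
  qed
  then show ?case using Q(1) N by (intro exI[of _ "Q \<inter> N s i"]) auto
qed

lemma inj_if_cylinders_separated:
  assumes "\<And>s. \<exists>Q. openin Z Q \<and> (\<forall>c. g c \<in> Q \<longleftrightarrow> c \<in> cyl s)"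
  shows "inj g"
proof (rule injI)
  fix c c' assume "g c = g c'"
  show "c = c'"
  proof (rule natseq_eqI)
    fix s
    obtain Q where "\<forall>c. g c \<in> Q \<longleftrightarrow> c \<in> cyl s" using assms by blast
    then show "c \<in> cyl s \<longleftrightarrow> c' \<in> cyl s" using \<open>g c = g c'\<close> by metis
  qed
qed

text \<open>A tree of closed sets in the domain of \<open>f\<close>, of which \<open>F (s @ [i])\<close> are the children of
\<open>F s\<close>. In the domain, the children of a node converge to the point \<open>x s\<close>, and the
open sets \<open>U s i\<close> separate them from each other and from that point. In the range, the images of the
children are separated from each other by \<open>V s i\<close>, and all at once from \<open>f (x s)\<close> by the neighbourhood
\<open>W s\<close>. This difference between the two sides is the one between the two topologies.
The radii \<open>2 / Suc n\<close> only have to tend to zero.\<close>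

locale oscillation_scheme = X: Metric_space MX dX + Y: Metric_space MY dY
  for MX :: "'a set" and dX and MY :: "'b set" and dY +
  fixes f :: "'a \<Rightarrow> 'b"
    and F :: "nat list \<Rightarrow> 'a set" and x :: "nat list \<Rightarrow> 'a"
    and U :: "nat list \<Rightarrow> nat \<Rightarrow> 'a set"
    and V :: "nat list \<Rightarrow> nat \<Rightarrow> 'b set" and W :: "nat list \<Rightarrow> 'b set"
  assumes complete: X.mcomplete
    and f_maps: "f \<in> MX \<rightarrow> MY"
    and F_closed: "closedin X.mtopology (F s)"
    and x_in: "x s \<in> F s"
    and F_child: "F (s @ [i]) \<subseteq> F s \<inter> U s i"
    and F_near: "p \<in> F (s @ [i]) \<Longrightarrow> dX (x s) p < 2 / Suc i"
    and F_small: "\<lbrakk>p \<in> F (s @ [i]); q \<in> F (s @ [i])\<rbrakk> \<Longrightarrow> dX p q < 2 / Suc (length s)"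
    and f_child: "p \<in> F (s @ [i]) \<Longrightarrow> f p \<in> V s i"
    and f_small: "\<lbrakk>p \<in> F (s @ [i]); q \<in> F (s @ [i])\<rbrakk> \<Longrightarrow> dY (f p) (f q) < 2 / Suc (length s)"
    and U_open: "openin X.mtopology (U s i)"
    and U_disjoint: "i \<noteq> j \<Longrightarrow> U s i \<inter> U s j = {}"
    and x_notin_U: "x s \<notin> U s i"
    and V_open: "openin Y.mtopology (V s i)"
    and V_disjoint: "i \<noteq> j \<Longrightarrow> V s i \<inter> V s j = {}"
    and W_open: "openin Y.mtopology (W s)"
    and fx_in_W: "f (x s) \<in> W s"
    and W_disjoint: "W s \<inter> V s i = {}"
begin

definition pt :: "natseq \<Rightarrow> 'a" where
  "pt c = (case c of Fin s \<Rightarrow> x s | Inf b \<Rightarrow> (SOME p. \<forall>n. p \<in> F (map b [0..<n])))"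

lemma F_subset: "F s \<subseteq> MX"
  using F_closed closedin_subset by fastforce

text \<open>Completeness provides a common point of the nested closed sets along a branch, whose diameters tend to zero.\<close>

lemma pt_in_F_branch: "pt (Inf b) \<in> F (map b [0..<n])"
proof -
  define C where "C n = F (map b [0..<n])" for n
  have C_Suc: "C (Suc n) = F (map b [0..<n] @ [b n])" for n
    by (simp add: C_def)
  have "decseq C"
    by (rule decseq_SucI) (use F_child C_Suc C_def in fastforce)
  moreover have "\<exists>n a. C n \<subseteq> X.mcball a e" if "e > 0" for e
  proof -
    obtain n where n: "2 / real (Suc n) < e"
      using ex_two_over_Suc_less[OF \<open>e > 0\<close>] by blast
    have "C (Suc n) \<subseteq> X.mcball (x (map b [0..<n] @ [b n])) e"
    proof
      fix p assume "p \<in> C (Suc n)"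
      then have p: "p \<in> F (map b [0..<n] @ [b n])" by (simp only: C_Suc)
      from F_small[OF x_in this] n have "dX (x (map b [0..<n] @ [b n])) p \<le> e" by simp
      then show "p \<in> X.mcball (x (map b [0..<n] @ [b n])) e"
        using p F_subset x_in by (meson X.in_mcball subsetD)
    qed
    then show ?thesis by blast
  qed
  moreover have "closedin X.mtopology (C n)" "C n \<noteq> {}" for n
    using F_closed x_in unfolding C_def by blast+
  ultimately have "\<Inter> (range C) \<noteq> {}"
    using complete unfolding X.mcomplete_nest by blast
  then have "\<exists>p. \<forall>n. p \<in> F (map b [0..<n])" unfolding C_def by blast
  then have "\<forall>n. (SOME p. \<forall>n. p \<in> F (map b [0..<n])) \<in> F (map b [0..<n])" by (rule someI_ex)
  then show ?thesis by (simp add: pt_def)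
qed

lemma F_antimono: "F (s @ r) \<subseteq> F s"
proof (induction r rule: rev_induct)
  case (snoc i r)
  then show ?case using F_child[of "s @ r" i] by auto
qed simp

lemma pt_in_F: "c \<in> cyl s \<Longrightarrow> pt c \<in> F s"
proof (cases c)
  case (Fin t)
  moreover assume "c \<in> cyl s"
  ultimately obtain r where "t = s @ r" by (auto simp: cyl_def prefix_def)
  then show ?thesis using x_in[of t] F_antimono[of s r] Fin by (auto simp: pt_def)
next
  case (Inf b)
  moreover assume "c \<in> cyl s"
  ultimately have "s = map b [0..<length s]" by (simp add: cyl_def)
  then show ?thesis using pt_in_F_branch[of b "length s"] Inf by simp
qed

lemma pt_in_carrier: "pt c \<in> MX"
  using pt_in_F[of c "[]"] F_subset cyl_Nil by blast

lemma pt_Fin [simp]: "pt (Fin s) = x s"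
  by (simp add: pt_def)

lemma pt_separated: "\<exists>Q. openin X.mtopology Q \<and> (\<forall>c. pt c \<in> Q \<longleftrightarrow> c \<in> cyl s)"
proof (rule cylinders_separated[of _ U])
  fix s i c assume "c \<in> cyl (s @ [i])"
  then have "pt c \<in> F (s @ [i])" by (rule pt_in_F)
  then show "pt c \<in> U s i" using F_child by blast
qed (simp_all add: U_open U_disjoint x_notin_U pt_in_carrier)

lemma f_pt_separated: "\<exists>Q. openin Y.mtopology Q \<and> (\<forall>c. f (pt c) \<in> Q \<longleftrightarrow> c \<in> cyl s)"
proof (rule cylinders_separated[of _ V])
  fix s i c assume "c \<in> cyl (s @ [i])"
  then show "f (pt c) \<in> V s i" by (intro f_child pt_in_F)
next
  fix s i show "f (pt (Fin s)) \<notin> V s i"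
    using fx_in_W W_disjoint by auto
next
  fix c show "f (pt c) \<in> topspace Y.mtopology"
    using f_maps pt_in_carrier by auto
qed (simp_all add: V_open V_disjoint)

text \<open>Within the cylinder of \<open>s\<close>, the neighbourhood \<open>W s\<close> excludes the values at all proper
extensions at once.\<close>

lemma f_pt_separated_Fin: "\<exists>Q. openin Y.mtopology Q \<and> (\<forall>c. f (pt c) \<in> Q \<longleftrightarrow> c = Fin s)"
proof -
  obtain Q where Q: "openin Y.mtopology Q" "\<And>c. f (pt c) \<in> Q \<longleftrightarrow> c \<in> cyl s"
    using f_pt_separated by blast
  have "f (pt c) \<in> Q \<inter> W s \<longleftrightarrow> c = Fin s" for c
  proof
    assume c: "f (pt c) \<in> Q \<inter> W s"
    have "c \<notin> cyl (s @ [i])" for i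
      using c W_disjoint[of s i] f_child[OF pt_in_F, of c s i] by blast
    then show "c = Fin s" using c Q(2) cyl_split[of s] by blast
  next
    assume "c = Fin s"
    then show "f (pt c) \<in> Q \<inter> W s" using Q(2)[of "Fin s"] fx_in_W Fin_in_cyl by simp
  qed
  then show ?thesis using Q(1) W_open by (intro exI[of _ "Q \<inter> W s"]) auto
qed

text \<open>The complement of a cylinder is cut out by the complement of the closed set \<open>F s\<close>. An open set
is needed here because cylinders are clopen in the coarse topology.\<close>

lemma pt_separated_Compl: "\<exists>Q. openin X.mtopology Q \<and> (\<forall>c. pt c \<in> Q \<longleftrightarrow> c \<notin> cyl s)"
proof -
  have "pt c \<in> F s \<Longrightarrow> c \<in> cyl s" for c
  proof (induction s rule: rev_induct)
    case Nil
    then show ?case by (simp add: cyl_Nil)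
  next
    case (snoc i s)
    then have "c \<in> cyl s" "pt c \<in> U s i" using F_child by blast+
    moreover from this have "c \<noteq> Fin s" using x_notin_U by auto
    ultimately obtain j where j: "c \<in> cyl (s @ [j])" using cyl_split[of s] by blast
    then have "pt c \<in> U s j" using pt_in_F F_child by blast
    with \<open>pt c \<in> U s i\<close> U_disjoint[of i j s] j show ?case by blast
  qed
  then have "\<forall>c. pt c \<in> MX - F s \<longleftrightarrow> c \<notin> cyl s"
    using pt_in_carrier pt_in_F by blast
  moreover have "openin X.mtopology (MX - F s)"
    using F_closed[of s] by (simp add: closedin_def)
  ultimately show ?thesis by blast
qed

lemma branch_neighbourhood:
  assumes "e > 0"
  obtains s i where "Inf b \<in> cyl (s @ [i])" "2 / Suc (length s) < e"
proof -
  obtain n where n: "2 / real (Suc n) < e"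
    using ex_two_over_Suc_less[OF \<open>e > 0\<close>] by blast
  have "Inf b \<in> cyl (map b [0..<n] @ [b n])" by (simp add: cyl_def)
  moreover have "2 / Suc (length (map b [0..<n])) < e" using n by simp
  ultimately show thesis by (rule that)
qed

text \<open>At a finite sequence this is the convergence of the children to \<open>x s\<close>; at an infinite one it
follows from the shrinking diameters along the branch.\<close>

lemma continuous_pt: "continuous_map natseq_star X.mtopology pt"
  unfolding X.continuous_map_to_metric
proof (intro ballI allI impI)
  fix c :: natseq and e :: real assume "e > 0"
  show "\<exists>S. openin natseq_star S \<and> c \<in> S \<and> (\<forall>c'\<in>S. pt c' \<in> X.mball (pt c) e)"
  proof (cases c)
    case (Fin s)
    obtain k where k: "2 / real (Suc k) < e"
      using ex_two_over_Suc_less[OF \<open>e > 0\<close>] by blast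
    have "pt c' \<in> X.mball (pt c) e" if "c' \<in> cofinite_cyl s k" for c'
      using that
    proof (cases rule: cofinite_cyl_cases)
      case 1
      then show ?thesis using Fin pt_in_carrier[of c] \<open>e > 0\<close> by simp
    next
      case (2 i)
      then have "dX (pt c) (pt c') < 2 / Suc i" using Fin F_near pt_in_F by simp
      also have "\<dots> \<le> 2 / Suc k" using 2 by (simp add: frac_le)
      finally show ?thesis using k pt_in_carrier by simp
    qed
    then show ?thesis using openin_cofinite_cyl Fin_in_cofinite_cyl Fin by blast
  next
    case (Inf b)
    obtain s i where si: "c \<in> cyl (s @ [i])" "2 / Suc (length s) < e"
      using branch_neighbourhood[OF \<open>e > 0\<close>, of b] unfolding Inf .
    have "pt c' \<in> X.mball (pt c) e" if "c' \<in> cyl (s @ [i])" for c'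
      using F_small[OF pt_in_F[OF si(1)] pt_in_F[OF that]] si(2) pt_in_carrier by simp
    then show ?thesis using natseq_star_clopen(1) si(1) by blast
  qed
qed

text \<open>Finite sequences are isolated in the fine topology, so only infinite ones matter.\<close>

lemma continuous_f_pt: "continuous_map natseq_star_star Y.mtopology (f \<circ> pt)"
  unfolding Y.continuous_map_to_metric
proof (intro ballI allI impI)
  fix c :: natseq and e :: real assume "e > 0"
  have carrier: "f (pt c) \<in> MY" for c using f_maps pt_in_carrier by auto
  show "\<exists>S. openin natseq_star_star S \<and> c \<in> S \<and> (\<forall>c'\<in>S. (f \<circ> pt) c' \<in> Y.mball ((f \<circ> pt) c) e)"
  proof (cases c)
    case (Fin s)
    then show ?thesis
      using carrier[of c] \<open>e > 0\<close> natseq_star_star_open(2)[of s] by (intro exI[of _ "{Fin s}"]) auto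
  next
    case (Inf b)
    obtain s i where si: "c \<in> cyl (s @ [i])" "2 / Suc (length s) < e"
      using branch_neighbourhood[OF \<open>e > 0\<close>, of b] unfolding Inf .
    have "(f \<circ> pt) c' \<in> Y.mball ((f \<circ> pt) c) e" if "c' \<in> cyl (s @ [i])" for c'
      using f_small[OF pt_in_F[OF si(1)] pt_in_F[OF that]] si(2) carrier by simp
    then show ?thesis using natseq_star_star_open(1) si(1) by blast
  qed
qed

lemma embeds_f1:
  "function_embedding natseq_star natseq_star_star f1 X.mtopology Y.mtopology f pt (f \<circ> pt)"
proof -
  have "embedding_map natseq_star X.mtopology pt"
    unfolding natseq_star_def clopen_topology_def
  proof (rule embedding_map_generated)
    show "continuous_map (topology_generated_by (range cyl \<union> uminus ` range cyl)) X.mtopology pt"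
      using continuous_pt unfolding natseq_star_def clopen_topology_def .
    show "\<Union> (range cyl \<union> uminus ` range cyl) = UNIV" by blast
    show "inj pt" by (rule inj_if_cylinders_separated[OF pt_separated])
  qed (use pt_separated pt_separated_Compl in auto)
  moreover have "embedding_map natseq_star_star Y.mtopology (f \<circ> pt)"
    unfolding natseq_star_star_eq
  proof (rule embedding_map_generated)
    show "continuous_map (topology_generated_by (range cyl \<union> range (\<lambda>s. {Fin s}))) Y.mtopology (f \<circ> pt)"
      using continuous_f_pt unfolding natseq_star_star_eq .
    show "\<Union> (range cyl \<union> range (\<lambda>s. {Fin s})) = UNIV" using cyl_Nil by blast
    show "inj (f \<circ> pt)"
      by (rule inj_if_cylinders_separated[where Z = Y.mtopology]) (use f_pt_separated in simp)
  qed (use f_pt_separated f_pt_separated_Fin in auto)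
  ultimately show ?thesis
    unfolding function_embedding_def embedding_map_in_subtopology
    using pt_in_carrier by (auto simp: f1_def subtopology_UNIV)
qed

end

section \<open>Metric preliminaries\<close>

lemma (in Metric_space) separable_imp_second_countable:
  assumes "separable_space mtopology"
  shows "second_countable mtopology"
proof -
  obtain D where D: "countable D" "D \<subseteq> M" "mtopology closure_of D = M"
    using assms by (auto simp: separable_space_def)
  define \<B> where "\<B> = (\<lambda>(a, n). mball a (inverse (real (Suc n)))) ` (D \<times> UNIV)"
  have "\<exists>B\<in>\<B>. x \<in> B \<and> B \<subseteq> G" if G: "openin mtopology G" "x \<in> G" for G x
  proof -
    obtain r where r: "r > 0" "mball x r \<subseteq> G" using G unfolding openin_mtopology by blast
    obtain n where n: "inverse (real (Suc n)) < r / 2"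
      using reals_Archimedean[of "r / 2"] r(1) by auto
    have "x \<in> mtopology closure_of D" using G D(3) openin_subset by fastforce
    then have "\<forall>r>0. \<exists>a\<in>D. a \<in> mball x r" unfolding metric_closure_of by blast
    then obtain a where a: "a \<in> D" "a \<in> mball x (inverse (real (Suc n)))"
      by (metis inverse_positive_iff_positive of_nat_0_less_iff zero_less_Suc)
    have "x \<in> mball a (inverse (real (Suc n)))" using a(2) by (simp add: commute)
    moreover have "mball a (inverse (real (Suc n))) \<subseteq> mball x r"
      using a(2) n by (intro mball_subset) (auto simp: commute)
    ultimately show ?thesis using a(1) r(2) unfolding \<B>_def by blast
  qed
  moreover have "countable \<B>" unfolding \<B>_def using D(1) by simp
  moreover have "openin mtopology B" if "B \<in> \<B>" for B using that unfolding \<B>_def by auto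
  ultimately show ?thesis unfolding second_countable_def by blast
qed

text \<open>The factor \<open>1 / 8\<close> leaves room: the centres are at least \<open>d x a / 2\<close> apart, while the radii add
up to less than \<open>d x a / 4\<close>.\<close>

lemma (in Metric_space) disjoint_balls_towards_point:
  assumes "x \<in> M" "b \<in> M" "a \<in> M" and half: "d x b < d x a / 2"
  shows "mball a (d x a / 8) \<inter> mball b (d x b / 8) = {}"
proof (rule ccontr)
  assume "\<not> ?thesis"
  then obtain z where z: "z \<in> M" "d a z < d x a / 8" "d b z < d x b / 8" by auto
  have "d a b \<le> d a z + d b z"
    using triangle[of a z b] assms z(1) by (simp add: commute)
  moreover have "d x a \<le> d x b + d a b"
    using triangle[of x b a] assms by (simp add: commute)
  ultimately show False using half z nonneg[of x b] by linarith
qed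

text \<open>If some \<open>y m\<close> is a limit of other terms, choose terms approaching it so fast that each distance
is less than half of the one before, and take balls with radii proportional to these distances.
Otherwise every term is isolated in the range of the sequence, and balls with half the isolation radius are disjoint.\<close>

lemma (in Metric_space) disjoint_neighbourhoods_subsequence:
  fixes y :: "nat \<Rightarrow> 'a"
  assumes y: "range y \<subseteq> M" and inj: "inj y"
  shows "\<exists>r V. strict_mono (r :: nat \<Rightarrow> nat) \<and>
    (\<forall>i. openin mtopology (V i) \<and> y (r i) \<in> V i) \<and> (\<forall>i j. i \<noteq> j \<longrightarrow> V i \<inter> V j = {})"
proof (cases "\<exists>m. \<forall>e>0. \<exists>n. 0 < d (y m) (y n) \<and> d (y m) (y n) < e")
  case True
  then obtain m where m: "\<And>e. e > 0 \<Longrightarrow> \<exists>n. 0 < d (y m) (y n) \<and> d (y m) (y n) < e" by blast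
  define \<delta> where "\<delta> n = d (y m) (y n)" for n
  have ym: "y n \<in> M" for n using y by blast
  have ex: "\<exists>n>N. 0 < \<delta> n \<and> \<delta> n < e" if "e > 0" for N e
  proof -
    \<comment> \<open>Staying closer to \<open>y m\<close> than the first \<open>N\<close> terms forces an index beyond \<open>N\<close>.\<close>
    define e' where "e' = Min (insert e (\<delta> ` ({..N} - {m})))"
    have "e' > 0"
      unfolding e'_def using that inj ym by (auto simp: \<delta>_def inj_eq)
    then obtain n where n: "0 < \<delta> n" "\<delta> n < e'" using m unfolding \<delta>_def by blast
    have "n > N"
    proof (rule ccontr)
      assume "\<not> n > N"
      moreover have "n \<noteq> m" using n(1) ym by (auto simp: \<delta>_def)
      ultimately have "e' \<le> \<delta> n" unfolding e'_def by (intro Min_le) auto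
      with n(2) show False by simp
    qed
    moreover have "e' \<le> e" unfolding e'_def by (intro Min_le) auto
    ultimately show ?thesis using n by auto
  qed
  have "\<exists>r. \<forall>k. 0 < \<delta> (r k) \<and> (r k < r (Suc k) \<and> \<delta> (r (Suc k)) < \<delta> (r k) / 2)"
  proof (rule dependent_nat_choice)
    show "\<exists>n. 0 < \<delta> n" using ex[of 1 0] by auto
  next
    fix n k assume "0 < \<delta> n"
    then show "\<exists>l. 0 < \<delta> l \<and> n < l \<and> \<delta> l < \<delta> n / 2" using ex[of "\<delta> n / 2" n] by auto
  qed
  then obtain r where r: "\<And>k. 0 < \<delta> (r k)" "\<And>k. r k < r (Suc k)" "\<And>k. \<delta> (r (Suc k)) < \<delta> (r k) / 2"
    by blast
  have half: "\<delta> (r j) < \<delta> (r i) / 2" if "i < j" for i j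
    using that
  proof (induction j)
    case (Suc j)
    then show ?case using r(3)[of j] r(1)[of j] by (cases "i = j") auto
  qed simp
  have far: "mball (y (r i)) (\<delta> (r i) / 8) \<inter> mball (y (r j)) (\<delta> (r j) / 8) = {}" if "i < j" for i j
    using disjoint_balls_towards_point[OF ym ym ym, of m "r j" "r i"] half[OF that] unfolding \<delta>_def by blast
  show ?thesis
  proof (intro exI conjI allI impI)
    show "strict_mono r" by (rule strict_monoI_Suc) (rule r(2))
    show "y (r i) \<in> mball (y (r i)) (\<delta> (r i) / 8)" for i using r(1) ym by simp
    show "mball (y (r i)) (\<delta> (r i) / 8) \<inter> mball (y (r j)) (\<delta> (r j) / 8) = {}" if "i \<noteq> j" for i j
      using that far[of i j] far[of j i] by (cases "i < j") auto
  qed simp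
next
  case False
  then obtain e where e: "\<And>m. e m > 0" "\<And>m n. 0 < d (y m) (y n) \<Longrightarrow> e m \<le> d (y m) (y n)"
    by (metis linorder_not_le)
  have ym: "y n \<in> M" for n using y by blast
  show ?thesis
  proof (intro exI conjI allI impI)
    show "strict_mono (id :: nat \<Rightarrow> nat)" by (simp add: strict_mono_def)
    show "y (id i) \<in> mball (y i) (e i / 2)" for i using e(1) ym by simp
    show "mball (y i) (e i / 2) \<inter> mball (y j) (e j / 2) = {}" if "i \<noteq> j" for i j
    proof (rule ccontr)
      assume "\<not> ?thesis"
      then obtain z where z: "z \<in> M" "d (y i) z < e i / 2" "d (y j) z < e j / 2" by auto
      have "d (y i) (y j) \<le> d (y i) z + d (y j) z"
        using triangle[of "y i" z "y j"] ym z(1) by (simp add: commute)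
      moreover have "0 < d (y i) (y j)" using that inj ym by (simp add: inj_eq)
      ultimately show False using e(2)[of i j] e(2)[of j i] z by (simp add: commute)
    qed
  qed simp
qed

section \<open>The ideal of small sets\<close>

text \<open>The closed sets only have to cover \<open>A\<close>, which is what makes smallness pass to arbitrary
subsets, so that the small sets form a \<open>\<sigma>\<close>-ideal.\<close>

definition sigma_small :: "'a topology \<Rightarrow> 'b topology \<Rightarrow> ('a \<Rightarrow> 'b) \<Rightarrow> 'a set \<Rightarrow> bool" where
  "sigma_small X Y f A \<longleftrightarrow>
     (\<exists>\<C>. countable \<C> \<and> (\<forall>C\<in>\<C>. closedin X C \<and> continuous_map (subtopology X C) Y f) \<and> A \<subseteq> \<Union>\<C>)"

lemma sigma_continuous_closed_iff_small:
  "sigma_continuous_closed X Y f \<longleftrightarrow> sigma_small X Y f (topspace X)"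
proof
  assume "sigma_small X Y f (topspace X)"
  then obtain \<C> where \<C>: "countable \<C>" "\<forall>C\<in>\<C>. closedin X C \<and> continuous_map (subtopology X C) Y f"
    "topspace X \<subseteq> \<Union>\<C>"
    unfolding sigma_small_def by blast
  moreover from this have "\<Union>\<C> \<subseteq> topspace X" using closedin_subset by blast
  ultimately show "sigma_continuous_closed X Y f"
    unfolding sigma_continuous_closed_def by (intro exI[of _ \<C>]) blast
next
  assume "sigma_continuous_closed X Y f"
  then show "sigma_small X Y f (topspace X)"
    unfolding sigma_continuous_closed_def sigma_small_def by (metis order_refl)
qed

lemma sigma_small_mono: "\<lbrakk>sigma_small X Y f B; A \<subseteq> B\<rbrakk> \<Longrightarrow> sigma_small X Y f A"
  unfolding sigma_small_def by (meson order_trans)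

lemma sigma_small_Union:
  assumes "countable \<A>" "\<And>A. A \<in> \<A> \<Longrightarrow> sigma_small X Y f A"
  shows "sigma_small X Y f (\<Union>\<A>)"
proof -
  have "\<forall>A\<in>\<A>. \<exists>\<C>. countable \<C> \<and>
      (\<forall>C\<in>\<C>. closedin X C \<and> continuous_map (subtopology X C) Y f) \<and> A \<subseteq> \<Union>\<C>"
    using assms(2) unfolding sigma_small_def by blast
  then obtain \<C> where \<C>: "\<forall>A\<in>\<A>. countable (\<C> A) \<and>
      (\<forall>C\<in>\<C> A. closedin X C \<and> continuous_map (subtopology X C) Y f) \<and> A \<subseteq> \<Union>(\<C> A)"
    by metis
  show ?thesis
    unfolding sigma_small_def
  proof (intro exI conjI)
    show "countable (\<Union>A\<in>\<A>. \<C> A)" using assms(1) \<C> by blast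
    show "\<forall>C\<in>\<Union>A\<in>\<A>. \<C> A. closedin X C \<and> continuous_map (subtopology X C) Y f" using \<C> by blast
    show "\<Union>\<A> \<subseteq> \<Union>(\<Union>A\<in>\<A>. \<C> A)"
    proof
      fix a assume "a \<in> \<Union>\<A>"
      then obtain A where "A \<in> \<A>" "a \<in> A" by blast
      moreover from this have "A \<subseteq> \<Union>(\<C> A)" using \<C> by simp
      ultimately show "a \<in> \<Union>(\<Union>A\<in>\<A>. \<C> A)" by blast
    qed
  qed
qed

lemma sigma_small_Un:
  "\<lbrakk>sigma_small X Y f A; sigma_small X Y f B\<rbrakk> \<Longrightarrow> sigma_small X Y f (A \<union> B)"
  using sigma_small_Union[of "{A, B}" X Y f]
  by (metis Union_insert Union_empty Un_empty_right countable_empty countable_insert empty_iff insert_iff)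

lemma fsigma_not_small_contains_closed:
  assumes "fsigma_in X A" "\<not> sigma_small X Y f A"
  obtains C where "closedin X C" "C \<subseteq> A" "\<not> sigma_small X Y f C"
proof -
  obtain \<C> where \<C>: "countable \<C>" "\<C> \<subseteq> Collect (closedin X)" "\<Union>\<C> = A"
    using assms(1) unfolding fsigma_in_def union_of_def by (elim exE conjE) (rule that)
  then obtain C where "C \<in> \<C>" "\<not> sigma_small X Y f C"
    using assms(2) sigma_small_Union[of \<C> X Y f] by blast
  then show thesis using \<C>(2,3) by (intro that[of C]) blast+
qed

text \<open>A kernel of the graph of \<open>f\<close> over \<open>F\<close>: every product neighbourhood of \<open>(x, f x)\<close> cuts out a nonsmall part of \<open>F\<close>.\<close>

definition large_kernel :: "'a topology \<Rightarrow> 'b topology \<Rightarrow> ('a \<Rightarrow> 'b) \<Rightarrow> 'a set \<Rightarrow> 'a set" where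
  "large_kernel X Y f F = {x \<in> F. \<forall>U V. openin X U \<and> openin Y V \<and> x \<in> U \<and> f x \<in> V \<longrightarrow>
     \<not> sigma_small X Y f {z \<in> F \<inter> U. f z \<in> V}}"

lemma large_kernel_subset: "large_kernel X Y f F \<subseteq> F"
  by (auto simp: large_kernel_def)

text \<open>A point outside the kernel lies in a small set determined by a pair of basic open sets, and there are only
countably many such pairs.\<close>

lemma small_outside_kernel:
  assumes "second_countable X" "second_countable Y"
  shows "sigma_small X Y f (F - large_kernel X Y f F)"
proof -
  obtain \<B> where \<B>: "countable \<B>" "\<And>U. U \<in> \<B> \<Longrightarrow> openin X U"
    "\<And>U x. openin X U \<Longrightarrow> x \<in> U \<Longrightarrow> \<exists>B\<in>\<B>. x \<in> B \<and> B \<subseteq> U"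
    using assms(1) unfolding second_countable_def by metis
  obtain \<D> where \<D>: "countable \<D>" "\<And>U. U \<in> \<D> \<Longrightarrow> openin Y U"
    "\<And>U x. openin Y U \<Longrightarrow> x \<in> U \<Longrightarrow> \<exists>B\<in>\<D>. x \<in> B \<and> B \<subseteq> U"
    using assms(2) unfolding second_countable_def by metis
  define \<A> where "\<A> = {A \<in> (\<lambda>(B, D). {z \<in> F \<inter> B. f z \<in> D}) ` (\<B> \<times> \<D>). sigma_small X Y f A}"
  have "countable ((\<lambda>(B, D). {z \<in> F \<inter> B. f z \<in> D}) ` (\<B> \<times> \<D>))"
    using \<B>(1) \<D>(1) by simp
  then have "countable \<A>" unfolding \<A>_def by (rule countable_subset[rotated]) blast
  then have "sigma_small X Y f (\<Union>\<A>)"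
    by (rule sigma_small_Union) (simp add: \<A>_def)
  moreover have "F - large_kernel X Y f F \<subseteq> \<Union>\<A>"
  proof
    fix x assume x: "x \<in> F - large_kernel X Y f F"
    then obtain U V where UV: "openin X U" "openin Y V" "x \<in> U" "f x \<in> V"
      "sigma_small X Y f {z \<in> F \<inter> U. f z \<in> V}"
      unfolding large_kernel_def by blast
    obtain B where B: "B \<in> \<B>" "x \<in> B" "B \<subseteq> U" using \<B>(3)[OF UV(1,3)] by blast
    obtain D where D: "D \<in> \<D>" "f x \<in> D" "D \<subseteq> V" using \<D>(3)[OF UV(2,4)] by blast
    have "sigma_small X Y f {z \<in> F \<inter> B. f z \<in> D}"
      by (rule sigma_small_mono[OF UV(5)]) (use B D in blast)
    moreover have "{z \<in> F \<inter> B. f z \<in> D} \<in> (\<lambda>(B, D). {z \<in> F \<inter> B. f z \<in> D}) ` (\<B> \<times> \<D>)"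
      by (rule image_eqI[of _ _ "(B, D)"]) (use B(1) D(1) in simp_all)
    ultimately have "{z \<in> F \<inter> B. f z \<in> D} \<in> \<A>" unfolding \<A>_def by (intro CollectI conjI)
    moreover have "x \<in> {z \<in> F \<inter> B. f z \<in> D}" using x B D by simp
    ultimately show "x \<in> \<Union>\<A>" by (rule UnionI)
  qed
  ultimately show ?thesis by (rule sigma_small_mono)
qed

lemma sigma_small_fibre:
  assumes "fsigma_in X {x \<in> topspace X. f x = y}" "y \<in> topspace Y"
  shows "sigma_small X Y f {x \<in> topspace X. f x = y}"
proof -
  obtain \<C> where \<C>: "countable \<C>" "\<C> \<subseteq> Collect (closedin X)" "\<Union>\<C> = {x \<in> topspace X. f x = y}"
    using assms(1) unfolding fsigma_in_def union_of_def by (elim exE conjE) (rule that)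
  have "continuous_map (subtopology X C) Y f" if "C \<in> \<C>" for C
  proof (rule continuous_map_eq)
    show "continuous_map (subtopology X C) Y (\<lambda>_. y)" using assms(2) by simp
    fix x assume "x \<in> topspace (subtopology X C)"
    then have "x \<in> \<Union>\<C>" using that by auto
    then show "y = f x" unfolding \<C>(3) by simp
  qed
  then have "\<forall>C\<in>\<C>. closedin X C \<and> continuous_map (subtopology X C) Y f"
    using \<C>(2) by blast
  then show ?thesis
    unfolding sigma_small_def using \<C>(1,3) by (metis order_refl)
qed

text \<open>A nonsmall set is not covered by the small complement of the kernel together with finitely many
fibres, each of which is small because it is \<open>F\<^sub>\<sigma>\<close>.\<close>

lemma kernel_point_avoiding:
  assumes sc: "second_countable X" "second_countable Y"
    and f: "f \<in> topspace X \<rightarrow> topspace Y" and one: "fsigma_to_one X Y f"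
    and F: "F \<subseteq> topspace X"
    and z: "z \<in> large_kernel X Y f F" and U: "openin X U" "z \<in> U" and V: "openin Y V" "f z \<in> V"
    and T: "finite T"
  shows "\<exists>z'\<in>large_kernel X Y f F \<inter> U. f z' \<in> V - T"
proof (rule ccontr)
  assume none: "\<not> ?thesis"
  let ?fib = "\<lambda>y. {x \<in> topspace X. f x = y}"
  have "sigma_small X Y f (\<Union>(?fib ` (T \<inter> topspace Y)))"
  proof (rule sigma_small_Union)
    show "countable (?fib ` (T \<inter> topspace Y))" using T by (simp add: countable_finite)
    fix A assume "A \<in> ?fib ` (T \<inter> topspace Y)"
    then obtain y where "A = ?fib y" "y \<in> topspace Y" by auto
    then show "sigma_small X Y f A"
      using one unfolding fsigma_to_one_def by (simp add: sigma_small_fibre)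
  qed
  then have "sigma_small X Y f (F - large_kernel X Y f F \<union> \<Union>(?fib ` (T \<inter> topspace Y)))"
    by (intro sigma_small_Un small_outside_kernel sc)
  moreover have "{x \<in> F \<inter> U. f x \<in> V} \<subseteq> F - large_kernel X Y f F \<union> \<Union>(?fib ` (T \<inter> topspace Y))"
  proof
    fix x assume x: "x \<in> {x \<in> F \<inter> U. f x \<in> V}"
    show "x \<in> F - large_kernel X Y f F \<union> \<Union>(?fib ` (T \<inter> topspace Y))"
    proof (cases "x \<in> large_kernel X Y f F")
      case True
      then have "f x \<in> T" using none x by blast
      moreover have "f x \<in> topspace Y" "x \<in> topspace X" using x F f by auto
      ultimately show ?thesis by simp
    qed (use x in simp)
  qed
  ultimately have "sigma_small X Y f {x \<in> F \<inter> U. f x \<in> V}" by (rule sigma_small_mono)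
  then show False using z U V unfolding large_kernel_def by blast
qed

text \<open>It is enough to test continuity at points of the closure of \<open>G\<close> along \<open>G\<close>:
by the hypothesis, the value at a nearby point of the closure is a limit of values on \<open>G\<close>, so it stays
in a closed neighbourhood of \<open>f x\<close>.\<close>

lemma continuous_on_closure_if_limits:
  assumes reg: "regular_space Y" and f: "f \<in> topspace X \<rightarrow> topspace Y"
    and lim: "\<And>x W. \<lbrakk>x \<in> X closure_of G; openin Y W; f x \<in> W\<rbrakk> \<Longrightarrow>
       \<exists>U. openin X U \<and> x \<in> U \<and> f ` (U \<inter> G) \<subseteq> W"
  shows "continuous_map (subtopology X (X closure_of G)) Y f"
  unfolding continuous_map_eq_topcontinuous_at topcontinuous_at_def
proof (intro ballI conjI allI impI)
  let ?K = "X closure_of G"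
  have K: "?K \<subseteq> topspace X" by (rule closure_of_subset_topspace)
  show "f \<in> topspace (subtopology X ?K) \<rightarrow> topspace Y" using f by auto
  fix x W assume x: "x \<in> topspace (subtopology X ?K)" and W: "openin Y W \<and> f x \<in> W"
  have "closedin Y (topspace Y - W)" "f x \<in> topspace Y - (topspace Y - W)"
    using W openin_subset by auto
  then obtain W' where W': "openin Y W'" "f x \<in> W'" "disjnt (topspace Y - W) (Y closure_of W')"
    using reg unfolding regular_space by blast
  obtain U where U: "openin X U" "x \<in> U" "f ` (U \<inter> G) \<subseteq> W'"
    using lim[of x W'] W' x by auto
  have "f y \<in> W" if y: "y \<in> U" "y \<in> ?K" for y
  proof -
    have "f y \<in> Y closure_of W'"
      unfolding in_closure_of
    proof (intro conjI allI impI)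
      show "f y \<in> topspace Y" using y K f by blast
      fix T assume T: "f y \<in> T \<and> openin Y T"
      then obtain U' where U': "openin X U'" "y \<in> U'" "f ` (U' \<inter> G) \<subseteq> T"
        using lim[of y T] y by blast
      have "openin X (U \<inter> U')" "y \<in> U \<inter> U'" using U U' y by auto
      then obtain g where "g \<in> G" "g \<in> U \<inter> U'" using y(2) unfolding in_closure_of by blast
      then show "\<exists>y. y \<in> W' \<and> y \<in> T" using U U' by blast
    qed
    then show ?thesis using W'(3) closure_of_subset_topspace[of Y W'] by (auto simp: disjnt_iff)
  qed
  then show "\<exists>U. openin (subtopology X ?K) U \<and> x \<in> U \<and> (\<forall>y\<in>U. f y \<in> W)"
    using U x by (intro exI[of _ "U \<inter> ?K"]) (auto simp: openin_subtopology)
qed auto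

text \<open>The closure of the kernel is contained in \<open>F\<close> and is nonsmall, so \<open>f\<close> is not continuous on
it, and the discontinuity is visible along the kernel. The finite set \<open>T\<close> of forbidden values is
what allows an injective sequence of values to be chosen later.\<close>

lemma kernel_discontinuity:
  assumes sc: "second_countable X" "second_countable Y" and reg: "regular_space Y"
    and f: "f \<in> topspace X \<rightarrow> topspace Y" and one: "fsigma_to_one X Y f"
    and F: "closedin X F" "\<not> sigma_small X Y f F"
  obtains x W V where "x \<in> F" "openin Y W" "openin Y V" "f x \<in> W" "W \<inter> V = {}"
    "\<And>U T. \<lbrakk>openin X U; x \<in> U; finite T\<rbrakk> \<Longrightarrow> \<exists>z\<in>large_kernel X Y f F \<inter> U. f z \<in> V - T"
proof -
  let ?G = "large_kernel X Y f F"
  let ?K = "X closure_of ?G"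
  have "?K \<subseteq> F" using F(1) large_kernel_subset by (metis closure_of_minimal)
  have "?G \<subseteq> topspace X" using large_kernel_subset closedin_subset[OF F(1)] by (rule order_trans)
  then have "?G \<subseteq> ?K" by (rule closure_of_subset)
  have "\<not> continuous_map (subtopology X ?K) Y f"
  proof
    assume "continuous_map (subtopology X ?K) Y f"
    then have "sigma_small X Y f ?K"
      unfolding sigma_small_def by (intro exI[of _ "{?K}"]) auto
    then have "sigma_small X Y f (?K \<union> (F - ?G))"
      using small_outside_kernel[OF sc] by (rule sigma_small_Un)
    then have "sigma_small X Y f F" by (rule sigma_small_mono) (use \<open>?G \<subseteq> ?K\<close> in blast)
    with F(2) show False by contradiction
  qed
  then obtain x W0 where x: "x \<in> ?K" and W0: "openin Y W0" "f x \<in> W0"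
    and osc: "\<And>U. \<lbrakk>openin X U; x \<in> U\<rbrakk> \<Longrightarrow> \<not> f ` (U \<inter> ?G) \<subseteq> W0"
    using continuous_on_closure_if_limits[OF reg f] by metis
  have "closedin Y (topspace Y - W0)" "f x \<in> topspace Y - (topspace Y - W0)"
    using W0 openin_subset by auto
  then obtain W V where WV: "openin Y W" "openin Y V" "f x \<in> W" "topspace Y - W0 \<subseteq> V" "disjnt W V"
    using reg unfolding regular_space_def by metis
  show thesis
  proof
    show "x \<in> F" using x \<open>?K \<subseteq> F\<close> by blast
    show "W \<inter> V = {}" using WV(5) by (simp add: disjnt_def)
    fix U and T :: "'b set" assume U: "openin X U" "x \<in> U" and T: "finite T"
    then obtain z where z: "z \<in> U" "z \<in> ?G" "f z \<notin> W0" using osc by blast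
    then have "f z \<in> V" using WV(4) f \<open>?G \<subseteq> topspace X\<close> by blast
    then show "\<exists>z\<in>?G \<inter> U. f z \<in> V - T"
      using kernel_point_avoiding[OF sc f one closedin_subset[OF F(1)] z(2) U(1) z(1) WV(2) _ T] by blast
  qed (rule WV)+
qed

section \<open>Building the tree of closed sets\<close>

text \<open>Since \<open>f\<close> is of Baire class one, the set \<open>{p \<in> F \<inter> U. f p \<in> V}\<close> is
\<open>F\<^sub>\<sigma>\<close>, and one of the countably many closed sets that make it up is nonsmall.
Working with closed sets, unlike the preimages themselves, keeps limits of branches under control.\<close>

lemma kernel_neighbourhood_contains_closed:
  assumes X: "metrizable_space X" and Baire: "Baire_class_one X Y f" and F: "closedin X F"
    and z: "z \<in> large_kernel X Y f F" and U: "openin X U" "z \<in> U" and V: "openin Y V" "f z \<in> V"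
  shows "\<exists>C. closedin X C \<and> C \<subseteq> {p \<in> F \<inter> U. f p \<in> V} \<and> \<not> sigma_small X Y f C"
proof -
  have "{p \<in> F \<inter> U. f p \<in> V} = F \<inter> U \<inter> {p \<in> topspace X. f p \<in> V}"
    using closedin_subset[OF F] by auto
  moreover have "fsigma_in X {p \<in> topspace X. f p \<in> V}"
    using Baire V(1) unfolding Baire_class_one_def by simp
  ultimately have "fsigma_in X {p \<in> F \<inter> U. f p \<in> V}"
    using fsigma_in_Int closed_imp_fsigma_in[OF F] open_imp_fsigma_in[OF X U(1)] by metis
  moreover have "\<not> sigma_small X Y f {p \<in> F \<inter> U. f p \<in> V}"
    using z U V unfolding large_kernel_def by blast
  ultimately show ?thesis by (rule fsigma_not_small_contains_closed) (intro exI conjI)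
qed

locale fsigma_to_one_Baire = X: Metric_space MX dX + Y: Metric_space MY dY
  for MX :: "'a set" and dX and MY :: "'b set" and dY +
  fixes f :: "'a \<Rightarrow> 'b"
  assumes complete: X.mcomplete
    and countable_X: "second_countable X.mtopology"
    and countable_Y: "second_countable Y.mtopology"
    and f_maps: "f \<in> MX \<rightarrow> MY"
    and one: "fsigma_to_one X.mtopology Y.mtopology f"
    and Baire: "Baire_class_one X.mtopology Y.mtopology f"
begin

abbreviation small :: "'a set \<Rightarrow> bool" where
  "small \<equiv> sigma_small X.mtopology Y.mtopology f"

text \<open>One branching of the tree: \<open>C i\<close> are the children of \<open>F\<close>. They are required to be nonsmall
so that they can be split in turn, and \<open>e\<close> bounds their size.\<close>

definition splitting ::
  "'a set \<Rightarrow> real \<Rightarrow> 'a \<Rightarrow> (nat \<Rightarrow> 'a set) \<Rightarrow> (nat \<Rightarrow> 'a set) \<Rightarrow> (nat \<Rightarrow> 'b set) \<Rightarrow> 'b set \<Rightarrow> bool"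
where
  "splitting F e x C U V W \<longleftrightarrow>
     x \<in> F \<and> openin Y.mtopology W \<and> f x \<in> W \<and>
     (\<forall>i. closedin X.mtopology (C i) \<and> \<not> small (C i) \<and> C i \<subseteq> F \<inter> U i \<and> f ` C i \<subseteq> V i \<and>
          openin X.mtopology (U i) \<and> x \<notin> U i \<and> openin Y.mtopology (V i) \<and> W \<inter> V i = {} \<and>
          (\<forall>p\<in>C i. dX x p < 2 / Suc i) \<and>
          (\<forall>p\<in>C i. \<forall>q\<in>C i. dX p q < 2 * e \<and> dY (f p) (f q) < 2 * e)) \<and>
     (\<forall>i j. i \<noteq> j \<longrightarrow> U i \<inter> U j = {} \<and> V i \<inter> V j = {})"

text \<open>Injectivity of \<open>f \<circ> z\<close> is achieved by forbidding, at each step, the finitely many earlier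
values. The halving of the distances to \<open>x\<close> survives passing to subsequences and makes suitable balls
around the \<open>z n\<close> disjoint.\<close>

lemma kernel_sequence:
  assumes F: "closedin X.mtopology F" "\<not> small F"
  obtains x W V z where "x \<in> F" "openin Y.mtopology W" "openin Y.mtopology V" "f x \<in> W" "W \<inter> V = {}"
    "\<And>n. z n \<in> large_kernel X.mtopology Y.mtopology f F" "\<And>n. f (z n) \<in> V"
    "\<And>n. dX x (z n) < 1 / Suc n" "\<And>m n. m < n \<Longrightarrow> dX x (z n) < dX x (z m) / 2" "inj (f \<circ> z)"
proof -
  let ?K = "large_kernel X.mtopology Y.mtopology f F"
  have f: "f \<in> topspace X.mtopology \<rightarrow> topspace Y.mtopology" using f_maps by simp
  obtain x W V where xWV: "x \<in> F" "openin Y.mtopology W" "openin Y.mtopology V" "f x \<in> W" "W \<inter> V = {}"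
    and osc: "\<And>U T. \<lbrakk>openin X.mtopology U; x \<in> U; finite T\<rbrakk> \<Longrightarrow> \<exists>z\<in>?K \<inter> U. f z \<in> V - T"
    by (rule kernel_discontinuity[OF countable_X countable_Y Y.regular_space_mtopology f one F])
      (rule that; assumption)
  have FM: "F \<subseteq> MX" using closedin_subset[OF F(1)] by simp
  have KM: "?K \<subseteq> MX" using FM large_kernel_subset by (rule order_trans[rotated])
  have xM: "x \<in> MX" using xWV(1) FM by blast
  define P where "P z n r \<longleftrightarrow> r \<in> ?K \<and> f r \<in> V \<and> dX x r < 1 / Suc n \<and>
    (\<forall>m<n. dX x r < dX x (z m) / 2 \<and> f r \<noteq> f (z m))" for z and n :: nat and r
  have "\<exists>z. \<forall>n. P z n (z n)"
  proof (rule dependent_wellorder_choice)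
    show "P z n r = P z' n r" if "\<And>m. m < n \<Longrightarrow> z m = z' m" for r z z' n
      using that by (simp add: P_def)
  next
    fix n z assume IH: "\<And>m. m < n \<Longrightarrow> P z m (z m)"
    define e where "e = Min (insert (1 / real (Suc n)) ((\<lambda>m. dX x (z m) / 2) ` {..<n}))"
    have "dX x (z m) > 0" if "m < n" for m
    proof -
      have "z m \<in> ?K" "f (z m) \<in> V" using IH[OF that] by (simp_all add: P_def)
      then have "z m \<in> MX" "z m \<noteq> x" using xWV(4,5) KM by blast+
      then show ?thesis using xM by simp
    qed
    then have "e > 0" unfolding e_def by (subst Min_gr_iff) auto
    then have "x \<in> X.mball x e" using xM by simp
    then obtain r where r: "r \<in> ?K" "r \<in> X.mball x e" "f r \<in> V" "f r \<notin> (\<lambda>m. f (z m)) ` {..<n}"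
      using osc[of "X.mball x e" "(\<lambda>m. f (z m)) ` {..<n}"] by auto
    have "e \<le> 1 / real (Suc n)" unfolding e_def by (rule Min_le) auto
    moreover have "e \<le> dX x (z m) / 2" if "m < n" for m
      unfolding e_def by (rule Min_le) (use that in auto)
    moreover have "dX x r < e" using r(2) by simp
    ultimately have "P z n r" unfolding P_def using r by fastforce
    then show "\<exists>r. P z n r" ..
  qed
  then obtain z where z: "\<forall>n. P z n (z n)" ..
  show thesis
  proof (rule that[OF xWV])
    show "inj (f \<circ> z)"
    proof (rule linorder_injI)
      fix m n :: nat assume "m < n"
      then have "f (z n) \<noteq> f (z m)" using z[rule_format, of n] unfolding P_def by blast
      then show "(f \<circ> z) m \<noteq> (f \<circ> z) n" by simp
    qed
  qed (use z in \<open>simp_all add: P_def\<close>)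
qed

text \<open>The subsequence \<open>a\<close> is chosen to make the values \<open>f (a i)\<close> strongly discrete. Around each
\<open>a i\<close> the set \<open>F\<close> is nonsmall even after restricting the values to a neighbourhood of
\<open>f (a i)\<close>, and a closed nonsmall piece of that part becomes the child \<open>C i\<close>.\<close>

lemma splitting_exists:
  assumes F: "closedin X.mtopology F" "\<not> small F" and e: "e > 0"
  shows "\<exists>x C U V W. splitting F e x C U V W"
proof (rule kernel_sequence[OF F])
  let ?K = "large_kernel X.mtopology Y.mtopology f F"
  fix x W V0 z assume x: "x \<in> F" and W: "openin Y.mtopology W"
    and V0: "openin Y.mtopology V0" and fx: "f x \<in> W" and disj: "W \<inter> V0 = {}"
    and z: "\<And>n. z n \<in> ?K" "\<And>n. f (z n) \<in> V0" "\<And>n. dX x (z n) < 1 / Suc n"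
    and half: "\<And>m n. m < n \<Longrightarrow> dX x (z n) < dX x (z m) / 2" and inj: "inj (f \<circ> z)"
  have FM: "F \<subseteq> MX" using closedin_subset[OF F(1)] by simp
  have zM: "z n \<in> MX" for n using z(1)[of n] large_kernel_subset FM by (meson subsetD)
  have xM: "x \<in> MX" using x FM by blast
  have fM: "f p \<in> MY" if "p \<in> MX" for p using f_maps that by (rule funcset_mem)
  have "range (f \<circ> z) \<subseteq> MY" using zM fM by auto
  from Y.disjoint_neighbourhoods_subsequence[OF this inj]
  obtain r :: "nat \<Rightarrow> nat" and V' where r: "strict_mono r"
    and V'_nbhd: "\<forall>i. openin Y.mtopology (V' i) \<and> (f \<circ> z) (r i) \<in> V' i"
    and V'_disj: "\<forall>i j. i \<noteq> j \<longrightarrow> V' i \<inter> V' j = {}"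
    by blast
  define a where "a i = z (r i)" for i
  have aM: "a i \<in> MX" and aK: "a i \<in> ?K" for i using zM z(1) by (simp_all add: a_def)
  have a_pos: "0 < dX x (a i)" for i
  proof -
    have "x \<noteq> a i" using z(2)[of "r i"] fx disj by (auto simp: a_def)
    then show ?thesis using xM aM by simp
  qed
  have a_half: "dX x (a j) < dX x (a i) / 2" if "i < j" for i j
    unfolding a_def using strict_monoD[OF r that] by (rule half)
  have a_near: "dX x (a i) < 1 / Suc i" for i
  proof -
    have "i \<le> r i" using r by (rule strict_mono_imp_increasing)
    then have "1 / real (Suc (r i)) \<le> 1 / Suc i" by (simp add: frac_le)
    then show ?thesis using z(3)[of "r i"] unfolding a_def by linarith
  qed
  define U where "U i = X.mball (a i) (min e (dX x (a i) / 8))" for i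
  define V where "V i = V' i \<inter> V0 \<inter> Y.mball (f (a i)) e" for i
  have a_U: "a i \<in> U i" for i using a_pos[of i] e aM by (simp add: U_def)
  have U_open: "openin X.mtopology (U i)" for i by (simp add: U_def)
  have U_far: "U i \<subseteq> X.mball (a i) (dX x (a i) / 8)" for i unfolding U_def by auto
  have V_open: "openin Y.mtopology (V i)" for i
    unfolding V_def using V'_nbhd by (intro openin_Int V0 Y.openin_mball) blast
  have fa_V: "f (a i) \<in> V i" for i
    using V'_nbhd[rule_format, of i] z(2)[of "r i"] e fM[OF aM] by (simp add: V_def a_def)
  have "\<exists>C. closedin X.mtopology C \<and> C \<subseteq> {p \<in> F \<inter> U i. f p \<in> V i} \<and> \<not> small C" for i
    by (rule kernel_neighbourhood_contains_closed[OF X.metrizable_space_mtopology Baire F(1) aK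
          U_open a_U V_open fa_V])
  then obtain C where C_all: "\<forall>i. closedin X.mtopology (C i) \<and> C i \<subseteq> {p \<in> F \<inter> U i. f p \<in> V i} \<and> \<not> small (C i)"
    by metis
  then have C: "closedin X.mtopology (C i)" "C i \<subseteq> {p \<in> F \<inter> U i. f p \<in> V i}" "\<not> small (C i)" for i
    by simp_all
  have "splitting F e x C U V W"
    unfolding splitting_def
  proof (intro conjI allI ballI impI)
    fix i
    show "x \<notin> U i" using a_pos[of i] by (simp add: U_def X.commute)
    show "W \<inter> V i = {}" using disj by (auto simp: V_def)
    fix p assume p: "p \<in> C i"
    then have pU: "p \<in> MX" "dX (a i) p < e" "dX (a i) p < dX x (a i) / 8"
      and pV: "dY (f (a i)) (f p) < e"
      using C(2)[of i] by (auto simp: U_def V_def)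
    show "dX x p < 2 / real (Suc i)"
    proof -
      have "dX x p \<le> dX x (a i) + dX (a i) p" using xM aM pU(1) by (rule X.triangle)
      also have "\<dots> < 2 * dX x (a i)" using pU(3) a_pos[of i] by linarith
      also have "\<dots> < 2 * (1 / Suc i)" using a_near[of i] by linarith
      finally show ?thesis by simp
    qed
    fix q assume q: "q \<in> C i"
    then have qU: "q \<in> MX" "dX (a i) q < e" and qV: "dY (f (a i)) (f q) < e"
      using C(2)[of i] by (auto simp: U_def V_def)
    show "dX p q < 2 * e"
      using X.triangle[OF pU(1) aM qU(1), of i] pU(2) qU(2) by (simp add: X.commute)
    show "dY (f p) (f q) < 2 * e"
      using Y.triangle[OF fM[OF pU(1)] fM[OF aM] fM[OF qU(1)], of i] pV qV by (simp add: Y.commute)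
  next
    fix i j :: nat assume "i \<noteq> j"
    then show "V i \<inter> V j = {}" using V'_disj[rule_format, of i j] by (auto simp: V_def)
    have "U i \<inter> U j = {}" if "i < j" for i j
      using X.disjoint_balls_towards_point[OF xM aM aM a_half[OF that]] U_far by blast
    with \<open>i \<noteq> j\<close> show "U i \<inter> U j = {}" by (metis inf_commute linorder_neqE_nat)
  qed (use x W fx C U_open V_open in blast)+
  then show "\<exists>x C U V W. splitting F e x C U V W" by blast
qed

lemma embeds_f1_if_not_small:
  assumes "\<not> small MX"
  shows "\<exists>\<pi>X \<pi>Y. function_embedding natseq_star natseq_star_star f1 X.mtopology Y.mtopology f \<pi>X \<pi>Y"
proof -
  have "\<forall>F e. closedin X.mtopology F \<and> \<not> small F \<and> e > 0 \<longrightarrow> (\<exists>x C U V W. splitting F e x C U V W)"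
    using splitting_exists by blast
  then obtain x C U V W where split: "\<And>F e. \<lbrakk>closedin X.mtopology F; \<not> small F; e > 0\<rbrakk> \<Longrightarrow>
      splitting F e (x F e) (C F e) (U F e) (V F e) (W F e)"
    by metis
  \<comment> \<open>The recursion runs over the reversed sequence because children are added at the end.\<close>
  define F where "F s = rec_list MX (\<lambda>i t A. C A (1 / Suc (length t)) i) (rev s)" for s
  define e where "e s = 1 / real (Suc (length s))" for s :: "nat list"
  have F_Nil: "F [] = MX" by (simp add: F_def)
  have F_snoc: "F (s @ [i]) = C (F s) (e s) i" for s i by (simp add: F_def e_def)
  have e_pos: "e s > 0" for s by (simp add: e_def)
  have big: "closedin X.mtopology (F s) \<and> \<not> small (F s)" for s
  proof (induction s rule: rev_induct)
    case Nil
    then show ?case using assms closedin_topspace[of X.mtopology] by (simp add: F_Nil)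
  next
    case (snoc i s)
    then have "splitting (F s) (e s) (x (F s) (e s)) (C (F s) (e s)) (U (F s) (e s)) (V (F s) (e s)) (W (F s) (e s))"
      using e_pos by (intro split) auto
    then show ?case unfolding splitting_def F_snoc by blast
  qed
  have "splitting (F s) (e s) (x (F s) (e s)) (\<lambda>i. F (s @ [i])) (U (F s) (e s)) (V (F s) (e s)) (W (F s) (e s))" for s
    using split[of "F s" "e s"] big[of s] e_pos by (simp add: F_snoc)
  note sp = this[unfolded splitting_def]
  interpret oscillation_scheme MX dX MY dY f F "\<lambda>s. x (F s) (e s)" "\<lambda>s. U (F s) (e s)"
    "\<lambda>s. V (F s) (e s)" "\<lambda>s. W (F s) (e s)"
  proof
    fix s i p q assume "p \<in> F (s @ [i])" "q \<in> F (s @ [i])"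
    then have "dX p q < 2 * e s \<and> dY (f p) (f q) < 2 * e s" using sp[of s] by blast
    then show "dX p q < 2 / real (Suc (length s))" "dY (f p) (f q) < 2 / real (Suc (length s))"
      by (simp_all add: e_def)
  next
    fix s i show "F (s @ [i]) \<subseteq> F s \<inter> U (F s) (e s) i" using sp[of s] by blast
  qed (use complete f_maps big sp in blast)+
  show ?thesis using embeds_f1 by blast
qed

end

theorem theorem2:
  fixes X :: "'a topology" and Y :: "'b topology" and f :: "'a \<Rightarrow> 'b"
  assumes "Polish_space X" and "Polish_space Y"
    and "f \<in> topspace X \<rightarrow> topspace Y"
    and "fsigma_to_one X Y f" and "Baire_class_one X Y f"
  shows "(sigma_continuous_closed X Y f \<or>
          (\<exists>\<pi>X \<pi>Y. function_embedding natseq_star natseq_star_star f1 X Y f \<pi>X \<pi>Y)) \<and>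
         \<not> (sigma_continuous_closed X Y f \<and>
          (\<exists>\<pi>X \<pi>Y. function_embedding natseq_star natseq_star_star f1 X Y f \<pi>X \<pi>Y))"
proof -
  let ?emb = "\<exists>\<pi>X \<pi>Y. function_embedding natseq_star natseq_star_star f1 X Y f \<pi>X \<pi>Y"
  obtain MX dX where X: "Metric_space MX dX" "Metric_space.mcomplete MX dX" "X = Metric_space.mtopology MX dX"
    using assms(1) unfolding Polish_space_def completely_metrizable_space_def by blast
  obtain MY dY where Y: "Metric_space MY dY" "Y = Metric_space.mtopology MY dY"
    using assms(2) unfolding Polish_space_def completely_metrizable_space_def by blast
  interpret X: Metric_space MX dX by (rule X(1))
  interpret Y: Metric_space MY dY by (rule Y(1))
  interpret fsigma_to_one_Baire MX dX MY dY f
  proof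
    show "second_countable X.mtopology" "second_countable Y.mtopology"
      using assms(1,2) X.separable_imp_second_countable Y.separable_imp_second_countable
      unfolding Polish_space_def X(3) Y(2) by blast+
    show "f \<in> MX \<rightarrow> MY" using assms(3) unfolding X(3) Y(2) by simp
  qed (use X(2) assms(4,5) in \<open>simp_all only: X(3) Y(2)\<close>)
  have "sigma_continuous_closed X Y f \<or> ?emb"
    using embeds_f1_if_not_small
    unfolding sigma_continuous_closed_iff_small X(3) Y(2) X.topspace_mtopology by blast
  moreover have "\<not> (sigma_continuous_closed X Y f \<and> ?emb)"
    using sigma_continuous_closed_if_embeds[of natseq_star natseq_star_star f1 X Y f]
      f1_not_sigma_continuous_closed by auto
  ultimately show ?thesis ..
qed

end
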